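(* Let $C=\times_{i\in I}C_i\subset\mathcal H$ be a product of $m$ nonempty compact convex sets with diameter $D$, let $f\colon\mathcal H\to\mathbb R$ be convex and $L_f$-smooth on $\mathcal H$, and let $\boldsymbol x^*$ be a minimizer of $f$ over $C$. Let $(\boldsymbol x_t)_{t\in\mathbb N}$ be generated by Short-Step Block-Coordinate Frank-Wolfe (described in the context), and suppose the positive integer $K$ satisfies $I=\bigcup_{k=t}^{t+K-1}I_k$ for every $t\in\mathbb N$. Set $$A_t=\sum_{k=1}^{K-1}G_{I_{t+k-1}\cap(I_{t+k}\cup\cdots\cup I_{t+K-1})}(\boldsymbol x_{t+k})\ge 0 .$$ Then, for every integer $n\ge1$, $$f(\boldsymbol x_{nK})-f(\boldsymbol x^* )\le\begin{cases}\displaystyle\frac{KL_fD^2}{2}-A_0&\text{if }n=1,\\[1em]\displaystyle\frac{2KL_fD^2}{n-1+\sum_{p=1}^{n}\left(\frac{2A_{pK}}{f(\boldsymbol x_1)-f(\boldsymbol x^* )}+\left(\frac{A_{pK}}{f(\boldsymbol x_1)-f(\boldsymbol x^* )}\right)^2\right)}&\text{if }n\ge2.\end{cases}$$ Furthermore, the algorithm requires one gradient evaluation per iteration.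
   Context: Notation. $I=\{1,\dots,m\}$; $\mathcal H=\bigoplus_{i\in I}\mathcal H_i$ is the direct sum of real Hilbert spaces with $\langle\boldsymbol x\mid\boldsymbol y\rangle=\sum_i\langle\boldsymbol x^i\mid\boldsymbol y^i\rangle$; the $\mathcal H_i$ are treated as orthogonal subspaces, so $\boldsymbol x=\sum_{i\in I}\boldsymbol x^i$ with $\boldsymbol x^i\in\mathcal H_i$, and $\boldsymbol x^J=\sum_{i\in J}\boldsymbol x^i$ for $J\subset I$. $C_i\subset\mathcal H_i$ is nonempty, compact, convex; $\times_{i\in J}C_i$ is the set of $\boldsymbol x\in\mathcal H$ with $\boldsymbol x^i\in C_i$ for $i\in J$ and $\boldsymbol x^i=0$ for $i\notin J$; $C=\times_{i\in I}C_i$. $f$ is Fréchet differentiable; for $L_f>0$, $f$ is $L_f$-smooth on a convex set $S$ if $f(\boldsymbol y)-f(\boldsymbol x)\le\langle\nabla f(\boldsymbol x)\mid\boldsymbol y-\boldsymbol x\rangle+\frac{L_f}{2}\|\boldsymbol y-\boldsymbol x\|^2$ for all $\boldsymbol x,\boldsymbol y\in S$. $\nabla^Jf(\boldsymbol x)=(\nabla f(\boldsymbol x))^J$. The linear minimization oracle $\mathrm{LMO}_J(\boldsymbol c)$ returns a point in $\operatorname{Argmin}_{\boldsymbol v\in\times_{i\in J}C_i}\langle\boldsymbol c^J\mid\boldsymbol v\rangle$, with $\mathrm{LMO}_i=\mathrm{LMO}_{\{i\}}$. The partial Frank-Wolfe gap is $G_J(\boldsymbol x)=\langle\nabla^Jf(\boldsymbol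 x)\mid\boldsymbol x^J-\mathrm{LMO}_J(\nabla^Jf(\boldsymbol x))\rangle$ for $\boldsymbol x\in C$, with $G_\varnothing=0$. Short-Step Block-Coordinate Frank-Wolfe. Input: $\boldsymbol x_0\in C$. For $t=0,1,2,\dots$: choose a nonempty block $I_t\subset I$; set $\boldsymbol g_t=\nabla f(\boldsymbol x_t)$; for $i\in I_t$ set $\boldsymbol v_t^i=\mathrm{LMO}_i(\boldsymbol g_t^i)$, $\gamma_t^i=\min\{1,\langle\boldsymbol g_t^i\mid\boldsymbol x_t^i-\boldsymbol v_t^i\rangle/(L_f\|\boldsymbol v_t^i-\boldsymbol x_t^i\|^2)\}$ (if $\boldsymbol x_t^i=\boldsymbol v_t^i$ the component is unchanged) and $\boldsymbol x_{t+1}^i=\boldsymbol x_t^i+\gamma_t^i(\boldsymbol v_t^i-\boldsymbol x_t^i)$; for $i\notin I_t$ set $\boldsymbol x_{t+1}^i=\boldsymbol x_t^i$. *)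

theory Defs
  imports "HOL-Analysis.Analysis"
begin

(* A finite orthogonal direct sum, in internal form: the summands are mutually orthogonal
   closed subspaces of the ambient Hilbert space whose sum is the whole space. *)
definition orthogonal_direct_sum :: "'i set \<Rightarrow> ('i \<Rightarrow> 'a::{real_inner,complete_space} set) \<Rightarrow> bool" where
  "orthogonal_direct_sum I H \<longleftrightarrow>
     finite I \<and>
     (\<forall>i\<in>I. subspace (H i) \<and> closed (H i)) \<and>
     (\<forall>i\<in>I. \<forall>j\<in>I. i \<noteq> j \<longrightarrow> (\<forall>u\<in>H i. \<forall>v\<in>H j. orthogonal u v)) \<and>
     (\<forall>x. \<exists>u. (\<forall>i\<in>I. u i \<in> H i) \<and> x = (\<Sum>i\<in>I. u i))"

(* x^i, the i-th component of x; the decomposition of x is unique when H is an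
   orthogonal direct sum. *)
definition block_comp :: "'i set \<Rightarrow> ('i \<Rightarrow> 'a::{real_inner,complete_space} set) \<Rightarrow> 'i \<Rightarrow> 'a \<Rightarrow> 'a" where
  "block_comp I H i x = (THE y. \<exists>u. (\<forall>j\<in>I. u j \<in> H j) \<and> x = (\<Sum>j\<in>I. u j) \<and> y = u i)"

definition block_part :: "'i set \<Rightarrow> ('i \<Rightarrow> 'a::{real_inner,complete_space} set) \<Rightarrow> 'i set \<Rightarrow> 'a \<Rightarrow> 'a" where
  "block_part I H J x = (\<Sum>i\<in>J. block_comp I H i x)"

(* The product of the C i with i in J, embedded in the whole space by zero components
   outside J. *)
definition block_prod ::
  "'i set \<Rightarrow> ('i \<Rightarrow> 'a::{real_inner,complete_space} set) \<Rightarrow> ('i \<Rightarrow> 'a set) \<Rightarrow> 'i set \<Rightarrow> 'a set" where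
  "block_prod I H C J =
     {x. (\<forall>i\<in>J. block_comp I H i x \<in> C i) \<and> (\<forall>i\<in>I - J. block_comp I H i x = 0)}"

definition L_smooth_on ::
  "real \<Rightarrow> ('a::real_inner \<Rightarrow> real) \<Rightarrow> ('a \<Rightarrow> 'a) \<Rightarrow> 'a set \<Rightarrow> bool" where
  "L_smooth_on L f grad S \<longleftrightarrow>
     (\<forall>x\<in>S. \<forall>y\<in>S. f y - f x \<le> grad x \<bullet> (y - x) + L / 2 * (norm (y - x))\<^sup>2)"

(* lmo is an arbitrary selection from the argmin sets. *)
definition is_LMO ::
  "'i set \<Rightarrow> ('i \<Rightarrow> 'a::{real_inner,complete_space} set) \<Rightarrow> ('i \<Rightarrow> 'a set)
    \<Rightarrow> ('i set \<Rightarrow> 'a \<Rightarrow> 'a) \<Rightarrow> bool" where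
  "is_LMO I H C lmo \<longleftrightarrow>
     (\<forall>J c. J \<subseteq> I \<longrightarrow>
        is_arg_min (\<lambda>v. block_part I H J c \<bullet> v) (\<lambda>v. v \<in> block_prod I H C J) (lmo J c))"

definition FW_gap ::
  "'i set \<Rightarrow> ('i \<Rightarrow> 'a::{real_inner,complete_space} set) \<Rightarrow> ('i set \<Rightarrow> 'a \<Rightarrow> 'a) \<Rightarrow> ('a \<Rightarrow> 'a)
    \<Rightarrow> 'i set \<Rightarrow> 'a \<Rightarrow> real" where
  "FW_gap I H lmo grad J x =
     (if J = {} then 0
      else block_part I H J (grad x)
             \<bullet> (block_part I H J x - lmo J (block_part I H J (grad x))))"

(* Programs whose only access to the gradient is by querying it at a point, so that the
   gradient evaluations made in an execution can be counted. *)
datatype ('x, 'g, 's) grad_prog =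
    Return 's
  | Eval_grad 'x "'g \<Rightarrow> ('x, 'g, 's) grad_prog"

primrec run_prog :: "('x \<Rightarrow> 'g) \<Rightarrow> ('x, 'g, 's) grad_prog \<Rightarrow> 's" where
  "run_prog grad (Return s) = s"
| "run_prog grad (Eval_grad x k) = run_prog grad (k (grad x))"

primrec num_grad_evals :: "('x \<Rightarrow> 'g) \<Rightarrow> ('x, 'g, 's) grad_prog \<Rightarrow> nat" where
  "num_grad_evals grad (Return s) = 0"
| "num_grad_evals grad (Eval_grad x k) = Suc (num_grad_evals grad (k (grad x)))"

(* If the component of x equals v then the quotient is 0 / 0 = 0; in any case the component
   is then left unchanged. *)
definition short_step ::
  "real \<Rightarrow> 'a::real_inner \<Rightarrow> 'a \<Rightarrow> 'a \<Rightarrow> 'a" where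
  "short_step L g x v =
     (let \<gamma> = min 1 (g \<bullet> (x - v) / (L * (norm (v - x))\<^sup>2)) in x + \<gamma> *\<^sub>R (v - x))"

(* SBCFW: Short-Step Block-Coordinate Frank-Wolfe. The oracle point lmo {i} _ has zero
   components outside i, so it is itself the i-th component of the target vertex. *)
definition SBCFW_iteration ::
  "'i set \<Rightarrow> ('i \<Rightarrow> 'a::{real_inner,complete_space} set) \<Rightarrow> ('i set \<Rightarrow> 'a \<Rightarrow> 'a) \<Rightarrow> real
    \<Rightarrow> 'i set \<Rightarrow> 'a \<Rightarrow> ('a, 'a, 'a) grad_prog" where
  "SBCFW_iteration I H lmo L B x =
     Eval_grad x (\<lambda>g. Return
       (\<Sum>i\<in>I. if i \<in> B
               then short_step L (block_comp I H i g) (block_comp I H i x)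
                      (lmo {i} (block_comp I H i g))
               else block_comp I H i x))"

definition SBCFW ::
  "'i set \<Rightarrow> ('i \<Rightarrow> 'a::{real_inner,complete_space} set) \<Rightarrow> ('i \<Rightarrow> 'a set) \<Rightarrow> ('i set \<Rightarrow> 'a \<Rightarrow> 'a)
    \<Rightarrow> real \<Rightarrow> ('a \<Rightarrow> 'a) \<Rightarrow> (nat \<Rightarrow> 'i set) \<Rightarrow> (nat \<Rightarrow> 'a) \<Rightarrow> bool" where
  "SBCFW I H C lmo L grad B x \<longleftrightarrow>
     x 0 \<in> block_prod I H C I \<and>
     (\<forall>t. B t \<noteq> {} \<and> B t \<subseteq> I) \<and>
     (\<forall>t. x (Suc t) = run_prog grad (SBCFW_iteration I H lmo L (B t) (x t)))"

definition gap_sum ::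
  "'i set \<Rightarrow> ('i \<Rightarrow> 'a::{real_inner,complete_space} set) \<Rightarrow> ('i set \<Rightarrow> 'a \<Rightarrow> 'a) \<Rightarrow> ('a \<Rightarrow> 'a)
    \<Rightarrow> nat \<Rightarrow> (nat \<Rightarrow> 'i set) \<Rightarrow> (nat \<Rightarrow> 'a) \<Rightarrow> nat \<Rightarrow> real" where
  "gap_sum I H lmo grad K B x t =
     (\<Sum>k=1..K-1. FW_gap I H lmo grad
        (B (t + k - 1) \<inter> (\<Union>j\<in>{t+k..t+K-1}. B j)) (x (t + k)))"

end

theory Submission imports Defs begin

text \<open>
  Fix \<open>s \<in> {0..1}\<close>. Over one cycle of \<open>K\<close> iterations the objective drops by at least
  \<open>s * (G I (x t) + A t) - s\<^sup>2 * K * L * D\<^sup>2 / 2\<close> (\<open>cycle_decrease\<close>), as a full Frank-Wolfe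
  step at \<open>x t\<close> with the gap enlarged by \<open>A t\<close> and the quadratic term multiplied by
  \<open>K\<close>. The difficulty is that a block updated late in the cycle moves along a later gradient
  than the one at \<open>x t\<close>. For convex smooth \<open>f\<close> this costs nothing: an iteration decreases
  \<open>f\<close> by an additional multiple of the squared change of the gradient
  (\<open>convex_smooth_gradient_bound\<close>), and this pays for the change of the gaps of the blocks that
  are still waiting (\<open>one_step_decrease\<close>). Gaps of blocks that are updated again within the
  cycle are counted in addition, and these make up \<open>A t\<close>.

  Let \<open>h p = f (x (p * K)) - f xstar\<close>, \<open>a p = A (p * K)\<close> and \<open>S = 2 * K * L * D\<^sup>2\<close>. By
  convexity \<open>h p \<le> G I (x (p * K))\<close>, so
  \<open>h p - h (Suc p) \<ge> s * (h p + a p) - s\<^sup>2 * S / 4\<close> for all \<open>s\<close>. The choice \<open>s = 1\<close> gives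
  \<open>h (Suc p) + a p \<le> S / 4\<close>, which contains the claim for \<open>n = 1\<close>. From \<open>p = 1\<close> on,
  the unconstrained optimum \<open>s = 2 * (h p + a p) / S\<close> is admissible and gives
  \<open>h p - h (Suc p) \<ge> (h p + a p)\<^sup>2 / S\<close>. If both values are positive, dividing by
  \<open>h p * h (Suc p)\<close> turns this into
  \<open>S / h (Suc p) \<ge> S / h p + (1 + a p / h p)\<^sup>2\<close>. Summation bounds \<open>S / h n\<close> from below with
  the terms \<open>p < n\<close> (\<open>decrease_recurrence_rate\<close>). The claimed bound also contains \<open>a n\<close>, a
  quantity of the cycle after \<open>x (n * K)\<close>; that term is covered by the initial value \<open>S / h 1\<close>,
  because the decrease in that cycle cannot exceed \<open>h n\<close>.
\<close>

section \<open>Components in an orthogonal direct sum\<close>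

locale orthogonal_blocks =
  fixes I :: "'i set" and H :: "'i \<Rightarrow> 'a::{real_inner,complete_space} set"
  assumes direct_sum: "orthogonal_direct_sum I H"
begin

abbreviation proj :: "'i \<Rightarrow> 'a \<Rightarrow> 'a" where "proj \<equiv> block_comp I H"

lemma finite_blocks: "finite I"
  using direct_sum by (simp add: orthogonal_direct_sum_def)

lemma subspace_block: "i \<in> I \<Longrightarrow> subspace (H i)"
  using direct_sum by (simp add: orthogonal_direct_sum_def)

lemma inner_distinct_blocks:
  "i \<in> I \<Longrightarrow> j \<in> I \<Longrightarrow> i \<noteq> j \<Longrightarrow> y \<in> H i \<Longrightarrow> z \<in> H j \<Longrightarrow> y \<bullet> z = 0"
  using direct_sum unfolding orthogonal_direct_sum_def orthogonal_def by blast

lemma inner_sum_blocks: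
  assumes u: "\<And>j. j \<in> I \<Longrightarrow> u j \<in> H j" and i: "i \<in> I" "y \<in> H i"
  shows "y \<bullet> (\<Sum>j\<in>I. u j) = y \<bullet> u i"
proof -
  have "y \<bullet> (\<Sum>j\<in>I. u j) = (\<Sum>j\<in>I. if j = i then y \<bullet> u i else 0)"
    unfolding inner_sum_right using i u by (intro sum.cong) (auto intro: inner_distinct_blocks)
  then show ?thesis using finite_blocks i by simp
qed

lemma block_comp_sum:
  assumes u: "\<And>j. j \<in> I \<Longrightarrow> u j \<in> H j" and i: "i \<in> I"
  shows "proj i (\<Sum>j\<in>I. u j) = u i"
  unfolding block_comp_def
proof (rule the_equality)
  show "\<exists>w. (\<forall>j\<in>I. w j \<in> H j) \<and> (\<Sum>j\<in>I. u j) = (\<Sum>j\<in>I. w j) \<and> u i = w i"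
    using u by blast
next
  fix y assume "\<exists>w. (\<forall>j\<in>I. w j \<in> H j) \<and> (\<Sum>j\<in>I. u j) = (\<Sum>j\<in>I. w j) \<and> y = w i"
  then obtain w where w: "\<And>j. j \<in> I \<Longrightarrow> w j \<in> H j" "(\<Sum>j\<in>I. u j) = (\<Sum>j\<in>I. w j)" "y = w i"
    by blast
  have "w i - u i \<in> H i" using w(1) u i subspace_block subspace_diff by blast
  then have "(w i - u i) \<bullet> w i = (w i - u i) \<bullet> u i"
    using inner_sum_blocks[of u, OF u i] inner_sum_blocks[of w, OF w(1) i] w(2) by simp
  then have "(w i - u i) \<bullet> (w i - u i) = 0" by (simp add: inner_diff_right)
  then show "y = u i" using w(3) by simp
qed

lemma
  shows block_comp_in: "i \<in> I \<Longrightarrow> proj i y \<in> H i"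
    and sum_block_comp: "(\<Sum>i\<in>I. proj i y) = y"
proof -
  obtain u where u: "\<forall>i\<in>I. u i \<in> H i" "y = (\<Sum>i\<in>I. u i)"
    using direct_sum unfolding orthogonal_direct_sum_def by blast
  then have *: "proj i y = u i" if "i \<in> I" for i using block_comp_sum that by simp
  show "i \<in> I \<Longrightarrow> proj i y \<in> H i" using * u by simp
  show "(\<Sum>i\<in>I. proj i y) = y" using * u by simp
qed

lemma block_comp_eqI:
  assumes "\<And>j. j \<in> I \<Longrightarrow> u j \<in> H j" "y = (\<Sum>j\<in>I. u j)" "i \<in> I"
  shows "proj i y = u i"
  using assms block_comp_sum by simp

lemma block_comp_diff: "i \<in> I \<Longrightarrow> proj i (y - z) = proj i y - proj i z"
  by (rule block_comp_eqI)
    (auto simp: sum_subtractf sum_block_comp intro: subspace_diff subspace_block block_comp_in)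

lemma block_comp_sum_subset:
  assumes "J \<subseteq> I" "\<And>j. j \<in> J \<Longrightarrow> u j \<in> H j" "i \<in> I"
  shows "proj i (\<Sum>j\<in>J. u j) = (if i \<in> J then u i else 0)"
proof (rule block_comp_eqI[where u = "\<lambda>j. if j \<in> J then u j else 0"])
  show "(\<Sum>j\<in>J. u j) = (\<Sum>j\<in>I. if j \<in> J then u j else 0)"
    using assms(1) finite_blocks by (simp add: sum.If_cases Int_absorb1)
qed (use assms subspace_0 subspace_block in auto)

lemma block_comp_block:
  assumes "i \<in> I" "j \<in> I" "y \<in> H j"
  shows "proj i y = (if i = j then y else 0)"
  using block_comp_sum_subset[of "{j}" "\<lambda>_. y" i] assms by auto

lemma block_comp_block_part:
  "J \<subseteq> I \<Longrightarrow> i \<in> I \<Longrightarrow> proj i (block_part I H J y) = (if i \<in> J then proj i y else 0)"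
  unfolding block_part_def by (rule block_comp_sum_subset) (auto intro: block_comp_in)

lemma inner_eq_sum_block_comp: "y \<bullet> z = (\<Sum>i\<in>I. proj i y \<bullet> proj i z)"
proof -
  have "y \<bullet> z = (\<Sum>i\<in>I. proj i y) \<bullet> z" by (simp add: sum_block_comp)
  also have "\<dots> = (\<Sum>i\<in>I. proj i y \<bullet> (\<Sum>j\<in>I. proj j z))"
    by (subst inner_sum_left) (simp only: sum_block_comp)
  also have "\<dots> = (\<Sum>i\<in>I. proj i y \<bullet> proj i z)"
    by (intro sum.cong refl inner_sum_blocks) (auto intro: block_comp_in)
  finally show ?thesis .
qed

lemma norm_sq_eq_sum_block_comp: "(norm y)\<^sup>2 = (\<Sum>i\<in>I. (norm (proj i y))\<^sup>2)"
  by (simp add: power2_norm_eq_inner) (rule inner_eq_sum_block_comp)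

lemma inner_block_part:
  assumes "J \<subseteq> I"
  shows "block_part I H J y \<bullet> z = (\<Sum>i\<in>J. proj i y \<bullet> proj i z)"
proof -
  have "block_part I H J y \<bullet> z = (\<Sum>i\<in>I. if i \<in> J then proj i y \<bullet> proj i z else 0)"
    unfolding inner_eq_sum_block_comp[of "block_part I H J y"]
    by (intro sum.cong) (auto simp: block_comp_block_part assms)
  then show ?thesis using assms finite_blocks by (simp add: sum.If_cases Int_absorb1)
qed

lemma block_part_idem:
  assumes "J \<subseteq> I"
  shows "block_part I H J (block_part I H J y) = block_part I H J y"
proof -
  have "proj i (block_part I H J y) = proj i y" if "i \<in> J" for i
    using that assms block_comp_block_part[OF assms, of i y] by auto
  then show ?thesis
    unfolding block_part_def[of I H J "block_part I H J y"] by (simp add: block_part_def)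
qed

end

section \<open>Gradients of smooth convex functions\<close>

lemma convex_on_imp_above_gradient:
  fixes f :: "'a::real_inner \<Rightarrow> real"
  assumes "convex_on UNIV f" "GDERIV f y :> d"
  shows "f z \<ge> f y + d \<bullet> (z - y)"
proof -
  define h where "h s = f (y + s *\<^sub>R (z - y))" for s
  have conv: "convex_on UNIV h"
  proof (rule convex_onI)
    fix s a b :: real assume s: "0 < s" "s < 1"
    have "y + ((1 - s) *\<^sub>R a + s *\<^sub>R b) *\<^sub>R (z - y)
        = (1 - s) *\<^sub>R (y + a *\<^sub>R (z - y)) + s *\<^sub>R (y + b *\<^sub>R (z - y))"
      by (simp add: algebra_simps)
    then show "h ((1 - s) *\<^sub>R a + s *\<^sub>R b) \<le> (1 - s) * h a + s * h b"
      unfolding h_def using convex_onD[OF assms(1), of s] s by simp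
  qed simp
  have "(f has_derivative (\<lambda>k. k \<bullet> d)) (at (y + 0 *\<^sub>R (z - y)))"
    using assms(2) by (simp add: gderiv_def)
  then have "(h has_derivative (\<lambda>s. (s *\<^sub>R (z - y)) \<bullet> d)) (at 0)"
    unfolding h_def by (rule has_derivative_compose[rotated]) (auto intro!: derivative_eq_intros)
  then have "(h has_field_derivative (d \<bullet> (z - y))) (at 0)"
    by (rule has_derivative_imp_has_field_derivative) (simp add: inner_commute)
  from convex_on_imp_above_tangent[where x = 1, OF conv _ _ _ this]
  have "h 1 - h 0 \<ge> (d \<bullet> (z - y)) * (1 - 0)" by simp
  then show ?thesis by (simp add: h_def)
qed

text \<open>A gradient step of length \<open>1 / L\<close> from \<open>y\<close>, for the function
  \<open>\<lambda>w. f w - grad z \<bullet> w\<close> with minimizer \<open>z\<close>, decreases it by at least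
  \<open>(norm (grad y - grad z))\<^sup>2 / (2 * L)\<close>. The endpoint of that step may leave a
  set that contains \<open>y\<close> and \<open>z\<close>, which is why smoothness and convexity are
  assumed on the whole space.\<close>

lemma convex_smooth_gradient_bound:
  fixes f :: "'a::real_inner \<Rightarrow> real"
  assumes conv: "convex_on UNIV f" and grad: "\<And>y. GDERIV f y :> grad y"
    and smooth: "L_smooth_on L f grad UNIV" and L: "L > 0"
  shows "f y \<ge> f z + grad z \<bullet> (y - z) + (norm (grad y - grad z))\<^sup>2 / (2 * L)"
proof -
  define e where "e = grad y - grad z"
  define w where "w = y - (1 / L) *\<^sub>R e"
  have "f w \<le> f y + grad y \<bullet> (w - y) + L / 2 * (norm (w - y))\<^sup>2"
    using smooth unfolding L_smooth_on_def by (auto simp: algebra_simps)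
  moreover have "f w \<ge> f z + grad z \<bullet> (w - z)"
    by (rule convex_on_imp_above_gradient[OF conv grad])
  moreover have "grad y \<bullet> (w - y) - grad z \<bullet> (w - z) = - (grad z \<bullet> (y - z)) - (norm e)\<^sup>2 / L"
    unfolding w_def power2_norm_eq_inner
    by (simp add: e_def inner_simps algebra_simps inner_commute diff_divide_distrib add_divide_distrib)
  moreover have "L / 2 * (norm (w - y))\<^sup>2 = (norm e)\<^sup>2 / (2 * L)"
    using L by (simp add: w_def power_divide power2_eq_square field_simps)
  moreover have "(norm e)\<^sup>2 / L = 2 * ((norm e)\<^sup>2 / (2 * L))" by simp
  ultimately show ?thesis unfolding e_def by linarith
qed

section \<open>Frank-Wolfe steps on a block\<close>

text \<open>The short step maximizes the concave quadratic \<open>\<lambda>s. s * b - L / 2 * s\<^sup>2 * d\<^sup>2\<close> over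
  \<open>{0..1}\<close>. Comparing it with an arbitrary \<open>s\<close>, instead of computing the maximum, lets one
  common \<open>s\<close> be used for all blocks and all iterations of a cycle. For \<open>d = 0\<close> the quotient
  in the step size is 0, and \<open>b = 0\<close> makes the claim trivial.\<close>

lemma short_step_size_optimal:
  fixes L d b s :: real
  assumes L: "L > 0" and b: "b \<ge> 0" "d = 0 \<Longrightarrow> b = 0" and s: "0 \<le> s" "s \<le> 1"
  defines "s0 \<equiv> min 1 (b / (L * d\<^sup>2))"
  shows "s * b - L / 2 * s\<^sup>2 * d\<^sup>2 \<le> s0 * b - L / 2 * s0\<^sup>2 * d\<^sup>2"
proof (cases "d = 0")
  case False
  define q where "q = L * d\<^sup>2"
  have q: "q > 0" using L False by (simp add: q_def)
  have "(s0 - s) * (b - q * s0) \<ge> 0"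
  proof (cases "b \<le> q")
    case True
    then have "s0 = b / q" using q by (simp add: s0_def q_def[symmetric])
    then show ?thesis using q by simp
  next
    case False
    then have "s0 = 1" using q by (simp add: s0_def q_def[symmetric])
    then show ?thesis using False s by simp
  qed
  moreover have "s0 * b - q / 2 * s0\<^sup>2 - (s * b - q / 2 * s\<^sup>2)
      = (s0 - s) * (b - q * s0) + q / 2 * (s0 - s)\<^sup>2"
    by (simp add: power2_eq_square field_simps)
  ultimately have "s * b - q / 2 * s\<^sup>2 \<le> s0 * b - q / 2 * s0\<^sup>2" using q
    by (smt (verit) mult_nonneg_nonneg zero_le_power2 divide_nonneg_nonneg)
  then show ?thesis by (simp add: q_def mult_ac)
qed (use b in simp)

lemma inner_le_weighted_squares:
  fixes y z :: "'a::real_inner"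
  assumes "L > 0"
  shows "y \<bullet> z \<le> (norm y)\<^sup>2 / (2 * L) + L / 2 * (norm z)\<^sup>2"
proof -
  have "0 \<le> (norm (y - L *\<^sub>R z))\<^sup>2 / (2 * L)" using assms by simp
  also have "\<dots> = (norm y)\<^sup>2 / (2 * L) + L / 2 * (norm z)\<^sup>2 - y \<bullet> z"
    using assms unfolding power2_norm_eq_inner
    by (simp add: inner_diff_left inner_diff_right inner_commute field_simps)
  finally show ?thesis by simp
qed

section \<open>Block gaps, iterations and cycles\<close>

locale block_frank_wolfe = orthogonal_blocks I H
  for I :: "'i set" and H :: "'i \<Rightarrow> 'a::{real_inner,complete_space} set" +
  fixes C :: "'i \<Rightarrow> 'a set" and lmo :: "'i set \<Rightarrow> 'a \<Rightarrow> 'a"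
    and f :: "'a \<Rightarrow> real" and grad :: "'a \<Rightarrow> 'a" and L :: real
  assumes C_subset: "i \<in> I \<Longrightarrow> C i \<subseteq> H i"
    and C_compact: "i \<in> I \<Longrightarrow> compact (C i)"
    and C_convex: "i \<in> I \<Longrightarrow> convex (C i)"
    and lmo: "is_LMO I H C lmo"
    and gradient: "GDERIV f y :> grad y"
    and convex: "convex_on UNIV f"
    and L_pos: "L > 0"
    and smooth: "L_smooth_on L f grad UNIV"
begin

abbreviation feasible :: "'a set" where "feasible \<equiv> block_prod I H C I"

abbreviation diam :: real where "diam \<equiv> diameter feasible"

abbreviation vertex :: "'i \<Rightarrow> 'a \<Rightarrow> 'a" where
  "vertex i y \<equiv> lmo {i} (proj i (grad y))"

abbreviation G :: "'i set \<Rightarrow> 'a \<Rightarrow> real" where "G \<equiv> FW_gap I H lmo grad"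

text \<open>The Frank-Wolfe gap of a single block, in the form in which it enters the step size.\<close>

definition block_gap :: "'i \<Rightarrow> 'a \<Rightarrow> real" where
  "block_gap i y = proj i (grad y) \<bullet> (proj i y - vertex i y)"

lemma feasible_iff: "y \<in> feasible \<longleftrightarrow> (\<forall>i\<in>I. proj i y \<in> C i)"
  by (simp add: block_prod_def)

lemma sum_in_block_prod:
  assumes "J \<subseteq> I" "\<And>i. i \<in> J \<Longrightarrow> u i \<in> C i"
  shows "(\<Sum>i\<in>J. u i) \<in> block_prod I H C J"
proof -
  have "proj i (\<Sum>i\<in>J. u i) = (if i \<in> J then u i else 0)" if "i \<in> I" for i
    using assms C_subset that by (intro block_comp_sum_subset) blast+
  then show ?thesis using assms by (auto simp: block_prod_def)
qed

lemma sum_block_comp_block_prod: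
  assumes "J \<subseteq> I" "y \<in> block_prod I H C J"
  shows "(\<Sum>i\<in>J. proj i y) = y"
proof -
  have "(\<Sum>i\<in>J. proj i y) = (\<Sum>i\<in>I. proj i y)"
    using assms finite_blocks by (intro sum.mono_neutral_left) (auto simp: block_prod_def)
  then show ?thesis by (simp add: sum_block_comp)
qed

lemma lmo_in: "J \<subseteq> I \<Longrightarrow> lmo J c \<in> block_prod I H C J"
  using lmo unfolding is_LMO_def is_arg_min_def by blast

lemma lmo_le:
  "J \<subseteq> I \<Longrightarrow> v \<in> block_prod I H C J \<Longrightarrow> block_part I H J c \<bullet> lmo J c \<le> block_part I H J c \<bullet> v"
  using lmo unfolding is_LMO_def is_arg_min_def by (meson not_le)

lemma vertex_in: "i \<in> I \<Longrightarrow> vertex i y \<in> C i"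
  using lmo_in[of "{i}" "proj i (grad y)"] sum_block_comp_block_prod[of "{i}" "vertex i y"]
  by (auto simp: block_prod_def)

lemma vertex_in_block: "i \<in> I \<Longrightarrow> vertex i y \<in> H i"
  using vertex_in C_subset by blast

lemma vertex_le:
  assumes "i \<in> I" "z \<in> C i"
  shows "proj i (grad y) \<bullet> vertex i y \<le> proj i (grad y) \<bullet> z"
proof -
  have "block_part I H {i} (proj i (grad y)) = proj i (grad y)"
    using assms(1) by (simp add: block_part_def block_comp_block block_comp_in)
  moreover have "z \<in> block_prod I H C {i}"
    using sum_in_block_prod[of "{i}" "\<lambda>_. z"] assms by auto
  ultimately show ?thesis using lmo_le[of "{i}" z "proj i (grad y)"] assms(1) by simp
qed

lemma block_gap_ge:
  assumes "i \<in> I" "z \<in> C i"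
  shows "block_gap i y \<ge> proj i (grad y) \<bullet> (proj i y - z)"
  using vertex_le[OF assms, of y] by (simp add: block_gap_def inner_diff_right)

lemma block_gap_nonneg: "i \<in> I \<Longrightarrow> y \<in> feasible \<Longrightarrow> block_gap i y \<ge> 0"
  using block_gap_ge[of i "proj i y" y] by (simp add: feasible_iff)

text \<open>A linear function separates over a product, so the value of the oracle for \<open>J\<close> is the
  sum of the values of the oracles for its blocks. The selected minimizers themselves may differ.\<close>

lemma FW_gap_eq_sum_block_gap:
  assumes J: "J \<subseteq> I"
  shows "G J y = (\<Sum>i\<in>J. block_gap i y)"
proof (cases "J = {}")
  case False
  define c where "c = block_part I H J (grad y)"
  define w where "w = lmo J c"
  have c_inner: "c \<bullet> z = (\<Sum>i\<in>J. proj i (grad y) \<bullet> proj i z)" for z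
    unfolding c_def by (rule inner_block_part[OF J])
  have w_in: "proj i w \<in> C i" if "i \<in> J" for i
    using lmo_in[OF J, of c] that by (simp add: w_def block_prod_def)
  define v where "v = (\<Sum>i\<in>J. vertex i y)"
  have v_in: "v \<in> block_prod I H C J"
    unfolding v_def using J vertex_in by (intro sum_in_block_prod) auto
  have v_comp: "proj i v = vertex i y" if "i \<in> J" for i
    using block_comp_sum_subset[OF J, of "\<lambda>i. vertex i y" i] vertex_in_block J that
    by (auto simp: v_def)
  have "c \<bullet> w \<le> c \<bullet> v"
    using lmo_le[OF J v_in, of c] block_part_idem[OF J] by (simp add: c_def w_def)
  moreover have "c \<bullet> v \<le> c \<bullet> w"
    unfolding c_inner using J by (intro sum_mono) (auto simp: v_comp intro!: vertex_le w_in)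
  ultimately have w: "c \<bullet> w = c \<bullet> v" by simp
  have "G J y = c \<bullet> block_part I H J y - c \<bullet> w"
    using False by (simp add: FW_gap_def c_def w_def inner_diff_right)
  also have "\<dots> = (\<Sum>i\<in>J. proj i (grad y) \<bullet> proj i y) - (\<Sum>i\<in>J. proj i (grad y) \<bullet> vertex i y)"
    unfolding w unfolding c_inner using J v_comp block_comp_block_part[OF J]
    by (intro arg_cong2[where f = minus] sum.cong) auto
  finally show ?thesis by (simp add: block_gap_def inner_diff_right sum_subtractf)
qed (simp add: FW_gap_def)

lemma FW_gap_nonneg: "J \<subseteq> I \<Longrightarrow> y \<in> feasible \<Longrightarrow> G J y \<ge> 0"
  by (subst FW_gap_eq_sum_block_gap) (auto intro!: sum_nonneg block_gap_nonneg)

lemma FW_gap_split: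
  assumes "J \<subseteq> I"
  shows "G J y = G (J \<inter> B) y + G (J - B) y"
proof -
  have "J \<inter> B \<subseteq> I" "J - B \<subseteq> I" using assms by auto
  then show ?thesis
    using sum.Int_Diff[of J "\<lambda>i. block_gap i y" B] finite_subset[OF assms finite_blocks] assms
    by (simp add: FW_gap_eq_sum_block_gap)
qed

text \<open>By convexity the linearization of \<open>f\<close> at \<open>y\<close> lies below \<open>f\<close>, and the gap measures
  how far the linearization can decrease on the product.\<close>

lemma optimality_le_FW_gap:
  assumes "z \<in> feasible"
  shows "f y - f z \<le> G I y"
proof -
  have "f y - f z \<le> grad y \<bullet> (y - z)"
    using convex_on_imp_above_gradient[OF convex gradient, of y z]
    by (simp add: inner_diff_right)
  also have "\<dots> = (\<Sum>i\<in>I. proj i (grad y) \<bullet> (proj i y - proj i z))"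
    unfolding inner_eq_sum_block_comp[of "grad y"] by (simp add: block_comp_diff)
  also have "\<dots> \<le> G I y"
    using assms by (subst FW_gap_eq_sum_block_gap) (auto simp: feasible_iff
        intro!: sum_mono block_gap_ge)
  finally show ?thesis .
qed

lemma bounded_feasible: "bounded feasible"
proof -
  have "\<forall>i\<in>I. \<exists>M. \<forall>z\<in>C i. norm z \<le> M"
    using compact_imp_bounded[OF C_compact] by (simp add: bounded_iff)
  then obtain M where M: "\<forall>i\<in>I. \<forall>z\<in>C i. norm z \<le> M i" by (rule bchoice[THEN exE])
  have "norm y \<le> (\<Sum>i\<in>I. M i)" if "y \<in> feasible" for y
  proof -
    have "norm y = norm (\<Sum>i\<in>I. proj i y)" by (simp add: sum_block_comp)
    also have "\<dots> \<le> (\<Sum>i\<in>I. M i)"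
      using that M by (intro sum_norm_le) (auto simp: feasible_iff)
    finally show ?thesis .
  qed
  then show ?thesis unfolding bounded_iff by blast
qed

text \<open>The single-block vertices together form one point of the product, so the squared distances
  to them in all blocks share a single \<open>diam\<^sup>2\<close> instead of costing one per block.\<close>

lemma sum_vertex_distance_le:
  assumes y: "y \<in> feasible"
  shows "(\<Sum>i\<in>I. (norm (vertex i y - proj i y))\<^sup>2) \<le> diam\<^sup>2"
proof -
  define v where "v = (\<Sum>i\<in>I. vertex i y)"
  have v: "v \<in> feasible" unfolding v_def using vertex_in by (intro sum_in_block_prod) auto
  have v_comp: "proj i v = vertex i y" if "i \<in> I" for i
    using block_comp_sum[of "\<lambda>i. vertex i y" i] vertex_in_block that by (simp add: v_def)
  have "(\<Sum>i\<in>I. (norm (vertex i y - proj i y))\<^sup>2) = (norm (v - y))\<^sup>2"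
    unfolding norm_sq_eq_sum_block_comp[of "v - y"] by (simp add: block_comp_diff v_comp)
  also have "\<dots> \<le> diam\<^sup>2"
    using diameter_bounded_bound[OF bounded_feasible v y]
    by (intro power_mono) (simp_all add: dist_norm)
  finally show ?thesis .
qed

definition step_size :: "'i set \<Rightarrow> 'a \<Rightarrow> 'i \<Rightarrow> real" where
  "step_size B y i =
     (if i \<in> B then min 1 (block_gap i y / (L * (norm (vertex i y - proj i y))\<^sup>2)) else 0)"

abbreviation next_iterate :: "'i set \<Rightarrow> 'a \<Rightarrow> 'a" where
  "next_iterate B y \<equiv> run_prog grad (SBCFW_iteration I H lmo L B y)"

lemma step_size_optimal:
  assumes "i \<in> B" "B \<subseteq> I" "y \<in> feasible" "0 \<le> s" "s \<le> 1"
  shows "s * block_gap i y - L / 2 * s\<^sup>2 * (norm (vertex i y - proj i y))\<^sup>2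
    \<le> step_size B y i * block_gap i y
      - L / 2 * (step_size B y i)\<^sup>2 * (norm (vertex i y - proj i y))\<^sup>2"
proof -
  have "norm (vertex i y - proj i y) = 0 \<Longrightarrow> block_gap i y = 0"
    by (simp add: block_gap_def)
  moreover have "block_gap i y \<ge> 0" using assms by (intro block_gap_nonneg) auto
  ultimately show ?thesis
    using short_step_size_optimal[OF L_pos _ _ assms(4,5)] assms(1)
    by (metis (no_types, lifting) step_size_def)
qed

lemma step_size_range:
  assumes "i \<in> I" "y \<in> feasible"
  shows "0 \<le> step_size B y i" "step_size B y i \<le> 1"
  using block_gap_nonneg[OF assms] L_pos by (auto simp: step_size_def)

lemma block_comp_next_iterate:
  assumes B: "B \<subseteq> I" and y: "y \<in> feasible" and i: "i \<in> I"
  shows "proj i (next_iterate B y) = proj i y + step_size B y i *\<^sub>R (vertex i y - proj i y)"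
    and "proj i (next_iterate B y) \<in> C i"
proof -
  define u where "u j = proj j y + step_size B y j *\<^sub>R (vertex j y - proj j y)" for j
  have u_in: "u j \<in> C j" if j: "j \<in> I" for j
  proof -
    have "u j = (1 - step_size B y j) *\<^sub>R proj j y + step_size B y j *\<^sub>R vertex j y"
      by (simp add: u_def algebra_simps)
    then show ?thesis
      using convexD_alt[OF C_convex[OF j], of "proj j y" "vertex j y" "step_size B y j"]
        step_size_range[OF j y] vertex_in[OF j] y j by (auto simp: feasible_iff)
  qed
  have "next_iterate B y = (\<Sum>j\<in>I. u j)"
    by (auto simp: SBCFW_iteration_def short_step_def u_def step_size_def block_gap_def Let_def
        intro!: sum.cong)
  moreover have "u j \<in> H j" if "j \<in> I" for j using u_in C_subset that by blast
  ultimately have "proj i (next_iterate B y) = u i"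
    using block_comp_sum[of u i] i by simp
  then show "proj i (next_iterate B y) = proj i y + step_size B y i *\<^sub>R (vertex i y - proj i y)"
    and "proj i (next_iterate B y) \<in> C i"
    using u_in[OF i] by (simp_all add: u_def)
qed

lemma next_iterate_feasible: "B \<subseteq> I \<Longrightarrow> y \<in> feasible \<Longrightarrow> next_iterate B y \<in> feasible"
  using block_comp_next_iterate(2) by (simp add: feasible_iff)

text \<open>The bound is a sum over blocks. The convexity bound
  \<open>convex_smooth_gradient_bound\<close> splits \<open>f y - f z\<close> into the contributions
  \<open>proj i (grad z) \<bullet> (proj i y - proj i z) + (norm (proj i e))\<^sup>2 / (2 * L)\<close>, where \<open>e\<close>
  is the change of the gradient.

  A block in \<open>B\<close> has moved, and its contribution is at least the decrease that the short step
  promises; the square of \<open>proj i e\<close> pays for having \<open>grad z\<close> in place of \<open>grad y\<close>. A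
  block outside \<open>B\<close> has not moved, so its gap can only have dropped because the gradient
  changed, and the square of \<open>proj i e\<close> pays for that drop. Hence, after one step, the gaps of the
  blocks still to be updated in \<open>U\<close> may be taken at the new iterate. In the term
  \<open>G (B \<inter> U) z\<close> the blocks of \<open>B\<close> that will be updated again are added back.\<close>

lemma one_step_decrease:
  assumes B: "B \<subseteq> I" and U: "U \<subseteq> I" and y: "y \<in> feasible" and s: "0 \<le> s" "s \<le> 1"
  defines "z \<equiv> next_iterate B y"
  shows "f y - f z \<ge> s * (G (B \<union> U) y - G U z + G (B \<inter> U) z) - s\<^sup>2 * L * diam\<^sup>2 / 2"
proof -
  define J where "J = U - B"
  define e where "e = grad y - grad z"
  define r where "r i = norm (vertex i y - proj i y)" for i
  have z: "z \<in> feasible" unfolding z_def by (rule next_iterate_feasible[OF B y])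
  have comp: "proj i z = proj i y + step_size B y i *\<^sub>R (vertex i y - proj i y)" if "i \<in> I" for i
    unfolding z_def by (rule block_comp_next_iterate[OF B y that])
  define w where "w i = (if i \<in> B then block_gap i y
      else if i \<in> J then block_gap i y - block_gap i z else 0)" for i
  have block: "s * w i - L / 2 * s\<^sup>2 * (r i)\<^sup>2
      \<le> proj i (grad z) \<bullet> (proj i y - proj i z) + (norm (proj i e))\<^sup>2 / (2 * L)"
    if i: "i \<in> I" for i
  proof -
    have ei: "proj i e = proj i (grad y) - proj i (grad z)"
      using i by (simp add: e_def block_comp_diff)
    consider "i \<in> B" | "i \<notin> B" "i \<in> J" | "i \<notin> B" "i \<notin> J" by blast
    then show ?thesis
    proof cases
      case 1
      define q where "q = step_size B y i"
      have d: "proj i y - proj i z = q *\<^sub>R (proj i y - vertex i y)"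
        using comp[OF i] by (simp add: q_def algebra_simps)
      have "proj i (grad y) \<bullet> (proj i y - proj i z) = q * block_gap i y"
        by (simp add: d block_gap_def)
      moreover have "(norm (proj i y - proj i z))\<^sup>2 = q\<^sup>2 * (r i)\<^sup>2"
        by (simp add: d r_def power_mult_distrib norm_minus_commute)
      moreover have "proj i e \<bullet> (proj i y - proj i z)
          \<le> (norm (proj i e))\<^sup>2 / (2 * L) + L / 2 * (norm (proj i y - proj i z))\<^sup>2"
        by (rule inner_le_weighted_squares[OF L_pos])
      moreover have "proj i e \<bullet> (proj i y - proj i z)
          = proj i (grad y) \<bullet> (proj i y - proj i z) - proj i (grad z) \<bullet> (proj i y - proj i z)"
        by (simp add: ei inner_diff_left)
      moreover have "s * block_gap i y - L / 2 * s\<^sup>2 * (r i)\<^sup>2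
          \<le> q * block_gap i y - L / 2 * q\<^sup>2 * (r i)\<^sup>2"
        unfolding r_def q_def by (rule step_size_optimal[OF 1 B y s])
      ultimately show ?thesis using 1 by (simp add: w_def mult.assoc)
    next
      case 2
      have d: "proj i z = proj i y" using comp[OF i] 2 by (simp add: step_size_def)
      have "block_gap i z \<ge> proj i (grad z) \<bullet> (proj i y - vertex i y)"
        using block_gap_ge[OF i vertex_in[OF i, of y], of z] d by simp
      then have "block_gap i y - block_gap i z \<le> proj i e \<bullet> (proj i y - vertex i y)"
        by (simp add: ei block_gap_def inner_diff_left)
      then have "s * (block_gap i y - block_gap i z) \<le> proj i e \<bullet> (s *\<^sub>R (proj i y - vertex i y))"
        using s by (simp add: mult_left_mono)
      also have "\<dots> \<le> (norm (proj i e))\<^sup>2 / (2 * L)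
          + L / 2 * (norm (s *\<^sub>R (proj i y - vertex i y)))\<^sup>2"
        by (rule inner_le_weighted_squares[OF L_pos])
      also have "(norm (s *\<^sub>R (proj i y - vertex i y)))\<^sup>2 = s\<^sup>2 * (r i)\<^sup>2"
        by (simp add: r_def power_mult_distrib norm_minus_commute)
      finally show ?thesis using 2 d by (simp add: w_def mult.assoc)
    next
      case 3
      have d: "proj i z = proj i y" using comp[OF i] 3 by (simp add: step_size_def)
      have "0 \<le> L / 2 * s\<^sup>2 * (r i)\<^sup>2" "0 \<le> (norm (proj i e))\<^sup>2 / (2 * L)"
        using L_pos by simp_all
      then show ?thesis using 3 d by (simp add: w_def)
    qed
  qed
  have JI: "J \<subseteq> I" using U by (auto simp: J_def)
  have gaps: "(\<Sum>i\<in>I. w i) = G (B \<union> U) y - G U z + G (B \<inter> U) z"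
  proof -
    have "(\<Sum>i\<in>I. w i) = (\<Sum>i\<in>I. (if i \<in> B then block_gap i y else 0)
            + (if i \<in> J then block_gap i y - block_gap i z else 0))"
      by (intro sum.cong) (auto simp: w_def J_def)
    also have "\<dots> = G B y + (G J y - G J z)"
      using B JI finite_blocks
      by (simp add: sum.distrib sum.If_cases Int_absorb1 FW_gap_eq_sum_block_gap sum_subtractf)
    also have "G B y + (G J y - G J z) = G (B \<union> U) y - G U z + G (B \<inter> U) z"
    proof -
      have "(B \<union> U) \<inter> B = B" "(B \<union> U) - B = J" "U \<inter> B = B \<inter> U" "U - B = J"
        by (auto simp: J_def)
      then show ?thesis using FW_gap_split[of "B \<union> U" y B] FW_gap_split[of U z B] B U by simp
    qed
    finally show ?thesis .
  qed
  have "s * (G (B \<union> U) y - G U z + G (B \<inter> U) z) - s\<^sup>2 * L * diam\<^sup>2 / 2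
      \<le> s * (G (B \<union> U) y - G U z + G (B \<inter> U) z) - L / 2 * s\<^sup>2 * (\<Sum>i\<in>I. (r i)\<^sup>2)"
  proof -
    have "L / 2 * s\<^sup>2 * (\<Sum>i\<in>I. (r i)\<^sup>2) \<le> L / 2 * s\<^sup>2 * diam\<^sup>2"
      unfolding r_def using sum_vertex_distance_le[OF y] L_pos by (intro mult_left_mono) auto
    then show ?thesis by (simp add: mult_ac)
  qed
  also have "\<dots> = (\<Sum>i\<in>I. s * w i - L / 2 * s\<^sup>2 * (r i)\<^sup>2)"
    unfolding gaps[symmetric] by (simp only: sum_subtractf sum_distrib_left)
  also have "\<dots> \<le> (\<Sum>i\<in>I. proj i (grad z) \<bullet> (proj i y - proj i z)
      + (norm (proj i e))\<^sup>2 / (2 * L))"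
    using block by (rule sum_mono)
  also have "\<dots> = grad z \<bullet> (y - z) + (norm e)\<^sup>2 / (2 * L)"
    unfolding inner_eq_sum_block_comp[of "grad z"] norm_sq_eq_sum_block_comp[of e]
    by (simp add: block_comp_diff sum.distrib sum_divide_distrib)
  also have "\<dots> \<le> f y - f z"
    using convex_smooth_gradient_bound[OF convex gradient smooth L_pos, of z y]
    unfolding e_def by linarith
  finally show ?thesis .
qed

context
  fixes B :: "nat \<Rightarrow> 'i set" and x :: "nat \<Rightarrow> 'a"
  assumes run: "SBCFW I H C lmo L grad B x"
begin

lemma blocks_subset: "B t \<subseteq> I" and iterate_Suc: "x (Suc t) = next_iterate (B t) (x t)"
  using run by (auto simp: SBCFW_def)

lemma iterates_feasible: "x t \<in> feasible"
proof (induction t)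
  case 0
  show ?case using run by (simp add: SBCFW_def)
next
  case (Suc t)
  then show ?case unfolding iterate_Suc by (rule next_iterate_feasible[OF blocks_subset])
qed

lemma decseq_values: "decseq (\<lambda>t. f (x t))"
  using one_step_decrease[OF blocks_subset empty_subsetI iterates_feasible, of 0]
  by (simp add: decseq_Suc_iff iterate_Suc)

lemma gap_sum_nonneg: "gap_sum I H lmo grad K B x t \<ge> 0"
  unfolding gap_sum_def using blocks_subset
  by (intro sum_nonneg FW_gap_nonneg iterates_feasible) blast

text \<open>Take for \<open>U\<close> in \<open>one_step_decrease\<close> the blocks that are still to be updated in the
  cycle. Then \<open>G (U k) (x (t + k))\<close> telescopes from \<open>G I (x t)\<close> to \<open>0\<close>, and the terms for
  blocks updated more than once add up to the gap sum.\<close>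

lemma cycle_decrease:
  assumes K: "K > 0" and cover: "I = (\<Union>k\<in>{t..t+K-1}. B k)" and s: "0 \<le> s" "s \<le> 1"
  shows "f (x t) - f (x (t + K))
    \<ge> s * (G I (x t) + gap_sum I H lmo grad K B x t) - s\<^sup>2 * real K * L * diam\<^sup>2 / 2"
proof -
  \<comment> \<open>the blocks updated in the iterations from \<open>t + k\<close> to the end of the cycle\<close>
  define U where "U k = (\<Union>j\<in>{t+k..t+K-1}. B j)" for k
  have U_sub: "U k \<subseteq> I" for k using blocks_subset by (auto simp: U_def)
  have partial: "n \<le> K \<Longrightarrow> f (x t) - f (x (t + n))
      \<ge> s * (G I (x t) - G (U n) (x (t + n))
              + (\<Sum>k=1..n. G (B (t + k - 1) \<inter> U k) (x (t + k))))
        - s\<^sup>2 * real n * L * diam\<^sup>2 / 2" for n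
  proof (induction n)
    case 0
    then show ?case using cover by (simp add: U_def)
  next
    case (Suc n)
    have "{t+n..t+K-1} = insert (t+n) {t+Suc n..t+K-1}" using Suc.prems by auto
    then have U_eq: "B (t + n) \<union> U (Suc n) = U n" by (simp add: U_def)
    have "f (x (t + n)) - f (x (t + Suc n))
        \<ge> s * (G (U n) (x (t + n)) - G (U (Suc n)) (x (t + Suc n))
                + G (B (t + n) \<inter> U (Suc n)) (x (t + Suc n))) - s\<^sup>2 * L * diam\<^sup>2 / 2"
      using one_step_decrease[OF blocks_subset[of "t + n"] U_sub[of "Suc n"]
          iterates_feasible[of "t + n"] s]
      by (simp add: U_eq iterate_Suc)
    with Suc show ?case by (simp add: algebra_simps add_divide_distrib)
  qed
  have U_K: "U K = {}" using K by (auto simp: U_def)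
  \<comment> \<open>the telescoping sum has a summand for \<open>k = K\<close>, which vanishes since no block is left\<close>
  have "(\<Sum>k=1..K. G (B (t + k - 1) \<inter> U k) (x (t + k))) = gap_sum I H lmo grad K B x t"
  proof -
    obtain K' where K': "K = Suc K'" using K gr0_conv_Suc by blast
    have "G (B (t + K - 1) \<inter> U K) (x (t + K)) = 0" by (simp add: U_K FW_gap_def)
    then show ?thesis by (simp add: gap_sum_def U_def K')
  qed
  then show ?thesis using partial[of K] by (simp add: U_K FW_gap_def)
qed

end

end

section \<open>The recurrence for the values at the ends of the cycles\<close>

text \<open>The summand for \<open>p = n\<close> needs an argument of its own, since the decrease controlled by
  \<open>a n\<close> only affects \<open>h (Suc n)\<close>. As \<open>(h n + a n)\<^sup>2 \<le> S * h n\<close>, it holds that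
  \<open>a n \<le> sqrt (S * h n) - h n\<close>, and the right-hand side is increasing in \<open>h n\<close> on
  \<open>{0..S / 4}\<close>, so \<open>a n \<le> sqrt (S * h 1) - h 1\<close>. This gives \<open>(1 + a n / h 1)\<^sup>2 \<le> S / h 1\<close>,
  and \<open>S / h 1\<close> is the initial value of the sum over the earlier cycles. Replacing \<open>h 1\<close> by
  the larger \<open>c\<close> only decreases the quotients \<open>a p / c\<close>.\<close>

lemma decrease_recurrence_rate:
  fixes h a :: "nat \<Rightarrow> real" and S c :: real and n :: nat
  assumes h: "\<And>p. h p \<ge> 0" and a: "\<And>p. a p \<ge> 0" and c: "h 1 \<le> c" and n: "n \<ge> 2"
    and S: "S \<ge> 0"
    and dec: "\<And>p s. 0 \<le> s \<Longrightarrow> s \<le> 1 \<Longrightarrow> h p - h (Suc p) \<ge> s * (h p + a p) - s\<^sup>2 * S / 4"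
  shows "h n \<le> S / (real n - 1 + (\<Sum>p=1..n. 2 * a p / c + (a p / c)\<^sup>2))"
proof (cases "h n > 0")
  case False
  have "c \<ge> 0" using h[of 1] c by linarith
  then have "(\<Sum>p=1..n. 2 * a p / c + (a p / c)\<^sup>2) \<ge> 0"
    using a by (intro sum_nonneg) (auto intro: divide_nonneg_nonneg)
  then have "S / (real n - 1 + (\<Sum>p=1..n. 2 * a p / c + (a p / c)\<^sup>2)) \<ge> 0"
    using S n by (intro divide_nonneg_nonneg) auto
  then show ?thesis using False by linarith
next
  case True
  have first: "h (Suc p) + a p \<le> S / 4" for p using dec[of 1 p] by simp
  have mono: "h (Suc p) \<le> h p" for p using dec[of 0 p] by simp
  have decm: "decseq h" using mono by (simp add: decseq_Suc_iff)
  have pos: "h p > 0" if "p \<le> n" for p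
    using decseqD[OF decm that] True by linarith
  have h1: "h p \<le> h 1" if "p \<ge> 1" for p using decseqD[OF decm that] .
  have "h 1 \<le> S / 4" using first[of 0] a[of 0] by simp
  then have Spos: "S > 0" using pos[of 1] n by simp
  \<comment> \<open>the optimal \<open>s = 2 * (h p + a p) / S\<close> is at most 1 because \<open>h p\<close> and \<open>a p\<close> are
    at most \<open>S / 4\<close>; for \<open>h p\<close> this needs a preceding cycle, so \<open>p \<ge> 1\<close>\<close>
  have quad: "h p - h (Suc p) \<ge> (h p + a p)\<^sup>2 / S" if "p \<ge> 1" for p
  proof -
    have "h p \<le> S / 4" using h1[OF that] \<open>h 1 \<le> S / 4\<close> by linarith
    moreover have "a p \<le> S / 4" using first[of p] h[of "Suc p"] by linarith
    ultimately have "2 * (h p + a p) / S \<le> 1" using Spos by (simp add: field_simps)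
    moreover have "0 \<le> 2 * (h p + a p) / S" using h a Spos by simp
    ultimately have "h p - h (Suc p)
        \<ge> 2 * (h p + a p) / S * (h p + a p) - (2 * (h p + a p) / S)\<^sup>2 * S / 4"
      using dec by blast
    moreover have "2 * (h p + a p) / S * (h p + a p) - (2 * (h p + a p) / S)\<^sup>2 * S / 4
        = (h p + a p)\<^sup>2 / S"
      using Spos by (simp add: power2_eq_square field_simps)
    ultimately show ?thesis by simp
  qed
  have cpos: "c > 0" using pos[of 1] c n by linarith
  have rec: "S / h (Suc p) \<ge> S / h p + (1 + a p / c)\<^sup>2" if p: "p \<ge> 1" "Suc p \<le> n" for p
  proof -
    have P: "h p > 0" "h (Suc p) > 0" using pos p by auto
    have "a p / c \<le> a p / h p"
      using h1[OF p(1)] c P a by (intro divide_left_mono) auto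
    then have "(1 + a p / c)\<^sup>2 \<le> (1 + a p / h p)\<^sup>2"
      using a[of p] cpos by (intro power_mono) auto
    also have "\<dots> = (h p + a p)\<^sup>2 / (h p * h p)"
      using P by (simp add: power2_eq_square field_simps)
    also have "\<dots> \<le> (h p + a p)\<^sup>2 / (h p * h (Suc p))"
      using P mono[of p] by (intro divide_left_mono) auto
    also have "\<dots> = S * ((h p + a p)\<^sup>2 / S) / (h p * h (Suc p))" using Spos by simp
    also have "\<dots> \<le> S * (h p - h (Suc p)) / (h p * h (Suc p))"
      using quad[OF p(1)] P Spos by (intro divide_right_mono mult_left_mono) auto
    also have "\<dots> = S / h (Suc p) - S / h p" using P by (simp add: field_simps)
    finally show ?thesis by simp
  qed
  have chain: "k + 1 \<le> n \<Longrightarrow> S / h (k + 1) \<ge> S / h 1 + (\<Sum>p=1..k. (1 + a p / c)\<^sup>2)" for k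
  proof (induction k)
    case (Suc k)
    then show ?case using rec[of "Suc k"] by simp
  qed simp
  have last: "(1 + a n / c)\<^sup>2 \<le> S / h 1"
  proof -
    define r where "r = sqrt (S * h n)"
    define r1 where "r1 = sqrt (S * h 1)"
    have "(h n + a n)\<^sup>2 / S \<le> h n" using quad[of n] h[of "Suc n"] n by linarith
    then have "(h n + a n)\<^sup>2 \<le> S * h n" using Spos by (simp add: field_simps)
    then have an: "h n + a n \<le> r" unfolding r_def by (rule real_le_rsqrt)
    have r: "r\<^sup>2 = S * h n" "r1\<^sup>2 = S * h 1" "0 \<le> r" "r \<le> r1"
      using Spos h[of n] h[of 1] h1[of n] n by (auto simp: r_def r1_def)
    have "r1\<^sup>2 \<le> (S / 2)\<^sup>2"
      using r(2) \<open>h 1 \<le> S / 4\<close> Spos by (simp add: power2_eq_square field_simps)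
    then have "r1 \<le> S / 2" by (rule power2_le_imp_le) (use Spos in simp)
    \<comment> \<open>monotonicity of \<open>q \<mapsto> q - q\<^sup>2 / S\<close> on \<open>{0..S / 2}\<close>, multiplied by \<open>S\<close>\<close>
    then have "(r1 - r) * (S - r1 - r) \<ge> 0" using r by (intro mult_nonneg_nonneg) auto
    then have "S * (r - h n) \<le> S * (r1 - h 1)"
      using r by (simp add: algebra_simps power2_eq_square)
    then have "r - h n \<le> r1 - h 1" using Spos by simp
    then have an1: "a n \<le> r1 - h 1" using an by linarith
    have h1p: "h 1 > 0" using pos n by simp
    have "a n / c \<le> a n / h 1" using c h1p a by (intro divide_left_mono) auto
    also have "\<dots> \<le> (r1 - h 1) / h 1" using an1 h1p by (intro divide_right_mono) auto
    finally have "1 + a n / c \<le> r1 / h 1" using h1p by (simp add: field_simps)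
    then have "(1 + a n / c)\<^sup>2 \<le> (r1 / h 1)\<^sup>2"
      using a[of n] cpos by (intro power_mono) auto
    also have "\<dots> = S / h 1" using r(2) h1p by (simp add: power_divide power2_eq_square)
    finally show ?thesis .
  qed
  have *: "(\<Sum>p=1..n. (1 + a p / c)\<^sup>2) \<le> S / h n"
  proof -
    obtain k where k: "n = k + 1" using n by (metis Suc_eq_plus1 Suc_le_D numeral_2_eq_2)
    show ?thesis using chain[of k] last k by simp
  qed
  have "(\<Sum>p=1..n. (1 + a p / c)\<^sup>2) = real n + (\<Sum>p=1..n. 2 * a p / c + (a p / c)\<^sup>2)"
    by (simp add: power2_sum sum.distrib algebra_simps)
  then have "real n - 1 + (\<Sum>p=1..n. 2 * a p / c + (a p / c)\<^sup>2) \<le> S / h n" using * by linarith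
  moreover have "real n - 1 + (\<Sum>p=1..n. 2 * a p / c + (a p / c)\<^sup>2) > 0"
  proof -
    have "(\<Sum>p=1..n. 2 * a p / c + (a p / c)\<^sup>2) \<ge> 0"
      using a cpos by (intro sum_nonneg) (auto intro: divide_nonneg_nonneg)
    then show ?thesis using n by simp
  qed
  ultimately show ?thesis using True by (simp add: field_simps)
qed

section \<open>Convergence rate\<close>

theorem corollary2p2:
  fixes m K :: nat
    and I :: "nat set"
    and H C :: "nat \<Rightarrow> 'a::{real_inner,complete_space} set"
    and f :: "'a \<Rightarrow> real"
    and grad :: "'a \<Rightarrow> 'a"
    and lmo :: "nat set \<Rightarrow> 'a \<Rightarrow> 'a"
    and L D :: real
    and xstar :: 'a
    and B :: "nat \<Rightarrow> nat set"
    and x :: "nat \<Rightarrow> 'a"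
    and A :: "nat \<Rightarrow> real"
  assumes "I = {1..m}"
    and "orthogonal_direct_sum I H"
    and "\<And>i. i \<in> I \<Longrightarrow> C i \<subseteq> H i \<and> C i \<noteq> {} \<and> compact (C i) \<and> convex (C i)"
    and "D = diameter (block_prod I H C I)"
    and "\<And>y. GDERIV f y :> grad y"
    and "convex_on UNIV f"
    and "L > 0"
    and "L_smooth_on L f grad UNIV"
    and "is_arg_min f (\<lambda>y. y \<in> block_prod I H C I) xstar"
    and "is_LMO I H C lmo"
    and "SBCFW I H C lmo L grad B x"
    and "K > 0"
    and "\<And>t. I = (\<Union>k\<in>{t..t+K-1}. B k)"
    and "\<And>t. A t = gap_sum I H lmo grad K B x t"
  shows "(\<forall>t. A t \<ge> 0) \<and>
    (\<forall>n\<ge>1. f (x (n * K)) - f xstar \<le>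
       (if n = 1 then real K * L * D\<^sup>2 / 2 - A 0
        else 2 * real K * L * D\<^sup>2 /
          (real n - 1 +
           (\<Sum>p=1..n. 2 * A (p * K) / (f (x 1) - f xstar)
                      + (A (p * K) / (f (x 1) - f xstar))\<^sup>2)))) \<and>
    (\<forall>t. num_grad_evals grad (SBCFW_iteration I H lmo L (B t) (x t)) = 1)"
proof -
  interpret block_frank_wolfe I H C lmo f grad L
    using assms by unfold_locales auto
  note run = assms(11)
  have xstar: "xstar \<in> feasible" "\<And>y. y \<in> feasible \<Longrightarrow> f xstar \<le> f y"
    using assms(9) by (auto simp: is_arg_min_def not_less)
  define S where "S = 2 * real K * L * D\<^sup>2"
  define h where "h p = f (x (p * K)) - f xstar" for p
  have A: "A t \<ge> 0" for t using gap_sum_nonneg[OF run] assms(14) by simp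
  have h: "h p \<ge> 0" for p using xstar(2)[OF iterates_feasible[OF run]] by (simp add: h_def)
  have dec: "h p - h (Suc p) \<ge> s * (h p + A (p * K)) - s\<^sup>2 * S / 4"
    if s: "0 \<le> s" "s \<le> 1" for p s
  proof -
    have "s * (h p + A (p * K)) \<le> s * (G I (x (p * K)) + A (p * K))"
      using optimality_le_FW_gap[OF xstar(1), of "x (p * K)"] s
      by (intro mult_left_mono) (auto simp: h_def)
    moreover have "Suc p * K = p * K + K" by simp
    ultimately show ?thesis
      using cycle_decrease[OF run assms(12,13) s, of "p * K"] assms(14)[of "p * K"]
      by (simp add: h_def S_def assms(4) mult_ac add.commute)
  qed
  have "h 1 \<le> f (x 1) - f xstar"
    using decseqD[OF decseq_values[OF run], of 1 K] assms(12) by (simp add: h_def)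
  moreover have "S \<ge> 0" using assms(7) by (simp add: S_def)
  ultimately have "h n \<le> S / (real n - 1 + (\<Sum>p=1..n. 2 * A (p * K) / (f (x 1) - f xstar)
                      + (A (p * K) / (f (x 1) - f xstar))\<^sup>2))" if "n \<ge> 2" for n
    using decrease_recurrence_rate[of h "\<lambda>p. A (p * K)" "f (x 1) - f xstar" n S] h A dec that by blast
  moreover have "h 1 \<le> real K * L * D\<^sup>2 / 2 - A 0"
    using dec[of 1 0] by (simp add: S_def mult_ac)
  ultimately have "f (x (n * K)) - f xstar \<le>
       (if n = 1 then real K * L * D\<^sup>2 / 2 - A 0
        else 2 * real K * L * D\<^sup>2 /
          (real n - 1 +
           (\<Sum>p=1..n. 2 * A (p * K) / (f (x 1) - f xstar)
                      + (A (p * K) / (f (x 1) - f xstar))\<^sup>2)))" if "n \<ge> 1" for n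
    using that by (cases "n = 1") (auto simp: h_def S_def)
  then show ?thesis using A by (simp add: SBCFW_iteration_def)
qed

end
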